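(* Let $A$ be a coherent quantale that is normal, and let $\gamma: Spec(A)\to Max(A)$ be the map sending each $p\in Spec(A)$ to the unique $m\in Max(A)$ with $p\leq m$. Then $\gamma$ is continuous as a map $Spec_F(A)\to Max_F(A)$ if and only if $Max_F(A)$ is a compact space.
   Context: A quantale here means a complete lattice $A$ with bottom $0$ and top $1$, with an associative commutative multiplication that distributes over arbitrary joins and has $1$ as unit. $K(A)$ is the set of compact elements. $A$ is coherent if every element is a join of compact elements, $1\in K(A)$, and $K(A)$ is closed under multiplication. An element $p<1$ is $m$-prime if for all $a,b\in A$, $ab\leq p$ implies $a\leq p$ or $b\leq p$; $Spec(A)$ is the set of $m$-prime elements. $Max(A)$ is the set of maximal elements of $A\setminus\{1\}$; for coherent $A$, $Max(A)\subseteq Spec(A)$. $A$ is normal if for all $a,b\in A$ with $a\vee b=1$ there exist $e,f\in A$ such that $a\vee e=b\vee f=1$ and $ef=0$. It is known that a coherent quantale is normal if and only if every $p\in Spec(A)$ lies below a unique $m\in Max(A)$, and that then $\gamma$ is a continuous retraction of the inclusion $Max(A)\subseteq Spec(A)$ for the topology on $Spec(A)$ whose closed sets are the $V(a)=\{p\in Spec(A): a\leq p\}$, $a\in A$ (and its restriction to $Max(A)$). $Spec_F(A)$ is $Spec(A)$ with the flat topology, having $\{V(c): c\in K(A)\}$ as a basis of open sets; $Max_F(A)$ is $Max(A)$ with the induced subspace topology. Compact means every open cover has a finite subcover. *)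

theory Defs
  imports "HOL-Analysis.Abstract_Topology"
begin

text \<open>The bottom and top elements 0 and 1 of the quantale are \<open>bot\<close> and \<open>1 = top\<close>.
  By commutativity, distributivity on one side is enough.\<close>

class quantale = complete_lattice + comm_monoid_mult +
  assumes one_eq_top: "1 = top"
    and mult_Sup_distrib: "a * Sup S = (SUP s\<in>S. a * s)"

definition compact_elements :: "'a::quantale set" where
  "compact_elements =
     {c. \<forall>S. c \<le> Sup S \<longrightarrow> (\<exists>F. finite F \<and> F \<subseteq> S \<and> c \<le> Sup F)}"

definition coherent_quantale :: "'a::quantale itself \<Rightarrow> bool" where
  "coherent_quantale _ \<longleftrightarrow>
     (\<forall>a::'a. \<exists>S. S \<subseteq> compact_elements \<and> a = Sup S) \<and>
     (1::'a) \<in> compact_elements \<and>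
     (\<forall>c\<in>compact_elements. \<forall>d\<in>compact_elements. c * (d::'a) \<in> compact_elements)"

definition normal_quantale :: "'a::quantale itself \<Rightarrow> bool" where
  "normal_quantale _ \<longleftrightarrow>
     (\<forall>a b::'a. sup a b = 1 \<longrightarrow> (\<exists>e f. sup a e = 1 \<and> sup b f = 1 \<and> e * f = bot))"

definition Spec :: "'a::quantale set" where
  "Spec = {p. p < 1 \<and> (\<forall>a b. a * b \<le> p \<longrightarrow> a \<le> p \<or> b \<le> p)}"

definition MaxSpec :: "'a::quantale set" where
  "MaxSpec = {m. m \<noteq> 1 \<and> (\<forall>x. x \<noteq> 1 \<and> m \<le> x \<longrightarrow> x = m)}"

definition V :: "'a::quantale \<Rightarrow> 'a set" where
  "V a = {p \<in> Spec. a \<le> p}"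

definition Spec_F :: "'a::quantale topology" where
  "Spec_F = topology (arbitrary union_of (\<lambda>U. U \<in> V ` compact_elements))"

definition Max_F :: "'a::quantale topology" where
  "Max_F = subtopology Spec_F MaxSpec"

text \<open>Only the values of \<open>\<gamma>\<close> on \<open>Spec\<close> are meaningful, and there only when the quantale is
  coherent and normal.\<close>

definition gamma :: "'a::quantale \<Rightarrow> 'a" where
  "gamma p = (THE m. m \<in> MaxSpec \<and> p \<le> m)"


text \<open>The sets \<open>V c\<close> with \<open>c\<close> compact do form a basis of a topology on \<open>Spec\<close>.\<close>

lemma bot_compact: "bot \<in> (compact_elements :: 'a::quantale set)"
  unfolding compact_elements_def by (auto intro!: exI[of _ "{}"])

lemma sup_compact:
  assumes "c \<in> compact_elements" "d \<in> compact_elements"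
  shows "sup c (d::'a::quantale) \<in> compact_elements"
  unfolding compact_elements_def
proof (intro CollectI allI impI)
  fix S :: "'a set"
  assume "sup c d \<le> Sup S"
  then have "c \<le> Sup S" "d \<le> Sup S" by auto
  then obtain F G where "finite F" "F \<subseteq> S" "c \<le> Sup F" "finite G" "G \<subseteq> S" "d \<le> Sup G"
    using assms unfolding compact_elements_def by blast
  then show "\<exists>F. finite F \<and> F \<subseteq> S \<and> sup c d \<le> Sup F"
    by (intro exI[of _ "F \<union> G"]) (auto simp: Sup_union_distrib intro: le_supI1 le_supI2)
qed

lemma V_inter: "V a \<inter> V b = V (sup a b)"
  unfolding V_def by auto

lemma openin_Spec_F:
  "openin Spec_F U \<longleftrightarrow> (\<exists>C \<subseteq> compact_elements. U = (\<Union>c\<in>C. V c))"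
proof -
  have "istopology (arbitrary union_of (\<lambda>U. U \<in> V ` (compact_elements :: 'a set)))"
    by (rule istopology_base) (auto simp: V_inter sup_compact)
  then have "openin Spec_F U \<longleftrightarrow> (\<exists>\<U>. \<U> \<subseteq> V ` compact_elements \<and> \<Union>\<U> = U)"
    unfolding Spec_F_def by (auto simp: topology_inverse' union_of_def arbitrary_def)
  then show ?thesis
    by (auto simp: subset_image_iff)
qed

lemma topspace_Spec_F: "topspace Spec_F = Spec"
proof
  show "topspace Spec_F \<subseteq> Spec"
    using openin_topspace[of Spec_F] unfolding openin_Spec_F V_def by blast
  have "openin Spec_F (V bot)"
    unfolding openin_Spec_F using bot_compact by blast
  then show "Spec \<subseteq> topspace Spec_F"
    using openin_subset unfolding V_def by fastforce
qed

end

theory Submission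
  imports Defs
begin

text \<open>The flat topology on \<open>Spec\<close> is always compact, so if \<open>\<gamma>\<close> is continuous then its image
  \<open>Max\<close> is compact. Conversely, the trace of \<open>V c\<close> on \<open>Max\<close> is clopen in the flat topology, since
  every maximal \<open>m\<close> not above \<open>c\<close> lies above some compact \<open>d\<close> with \<open>c \<squnion> d = 1\<close>. Compactness of \<open>Max\<close>
  therefore gives a single \<open>d\<close> with \<open>c \<squnion> d = 1\<close> such that every maximal element is above \<open>c\<close> or
  above \<open>d\<close>. If \<open>e f = 0\<close> and \<open>c \<squnion> e = d \<squnion> f = 1\<close>, with \<open>f\<close> compact, then the preimage of
  \<open>V c\<close> under \<open>\<gamma>\<close> is \<open>V f\<close>.\<close>

section \<open>Multiplication, order and comaximality in a quantale\<close>

lemma quantale_mult_sup: "a * sup b c = sup (a * b) (a * (c::'a::quantale))"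
  using mult_Sup_distrib[of a "{b, c}"] by simp

lemma quantale_mult_mono:
  fixes a b :: "'a::quantale"
  assumes "a \<le> c" "b \<le> d"
  shows "a * b \<le> c * d"
proof -
  have "a * b \<le> a * d"
    using quantale_mult_sup[of a b d] assms(2) by (metis sup.absorb_iff2 sup_ge1)
  also have "\<dots> \<le> c * d"
    using quantale_mult_sup[of d a c] assms(1) by (metis sup.absorb_iff2 sup_ge1 mult.commute)
  finally show ?thesis .
qed

lemma quantale_le_one: "(a::'a::quantale) \<le> 1"
  by (simp add: one_eq_top)

lemma quantale_one_le_iff: "1 \<le> a \<longleftrightarrow> a = (1::'a::quantale)"
  by (simp add: one_eq_top top_unique)

lemma quantale_mult_le: "a * b \<le> (a::'a::quantale)" "a * b \<le> b"
  using quantale_mult_mono[of a a b 1] quantale_mult_mono[of a 1 b b]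
  by (simp_all add: quantale_le_one)

text \<open>In the expanded product every term other than \<open>a * b\<close> has \<open>p\<close>
  as a factor, hence lies below \<open>p\<close>.\<close>

lemma quantale_sup_mult_sup_le: "sup p a * sup p b \<le> sup p (a * (b::'a::quantale))"
proof -
  have "sup p a * sup p b = sup (sup p a * p) (sup (b * p) (b * a))"
    by (metis quantale_mult_sup mult.commute)
  also have "\<dots> \<le> sup p (a * b)"
    using quantale_mult_le(2)[of "sup p a" p] quantale_mult_le(2)[of b p]
    by (auto simp: mult.commute[of b a] intro: le_supI1)
  finally show ?thesis .
qed

lemma comaximal_mult:
  fixes c :: "'a::quantale"
  assumes "sup c a = 1" "sup c b = 1"
  shows "sup c (a * b) = 1"
  using quantale_sup_mult_sup_le[of c a b] assms by (simp add: quantale_one_le_iff)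

text \<open>The witness is the product of the members of \<open>F\<close>: it lies below each
  factor, and comaximality with \<open>c\<close> survives products.\<close>

lemma comaximal_finite:
  fixes c :: "'a::quantale"
  assumes "finite F" "\<And>x. x \<in> F \<Longrightarrow> sup c x = 1"
  shows "\<exists>d. sup c d = 1 \<and> (\<forall>x\<in>F. d \<le> x)"
  using assms
proof (induction F)
  case empty
  show ?case
    by (auto simp: one_eq_top intro: exI[of _ top])
next
  case (insert y F)
  then obtain d where "sup c d = 1" "\<forall>x\<in>F. d \<le> x" by auto
  then show ?case
    using insert.prems comaximal_mult[of c y d] quantale_mult_le[of y d]
    by (intro exI[of _ "y * d"]) (auto intro: order_trans)
qed

section \<open>Existence of m-prime elements by Zorn's lemma\<close>

lemma Sup_finite_chain_mem:
  fixes F :: "'a::complete_lattice set"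
  assumes "finite F" "F \<noteq> {}" "\<And>x y. x \<in> F \<Longrightarrow> y \<in> F \<Longrightarrow> x \<le> y \<or> y \<le> x"
  shows "Sup F \<in> F"
  using assms
proof (induction F rule: finite_ne_induct)
  case (insert x F)
  then have "Sup F \<in> F" by auto
  with insert.prems have "x \<le> Sup F \<or> Sup F \<le> x" by auto
  then show ?case
    using \<open>Sup F \<in> F\<close> by (auto simp: sup.absorb1 sup.absorb2)
qed auto

text \<open>The analogue of primeness for an ideal maximal among those disjoint from a
  multiplicative set: if neither \<open>a\<close> nor \<open>b\<close> were below \<open>p\<close>,
  then \<open>sup p a\<close> and \<open>sup p b\<close> would dominate members of \<open>M\<close>
  whose product lies below \<open>sup p (a * b) = p\<close>.\<close>

lemma maximal_avoiding_in_Spec: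
  fixes p :: "'a::quantale"
  assumes M: "1 \<in> M" "\<And>s t. s \<in> M \<Longrightarrow> t \<in> M \<Longrightarrow> s * t \<in> M"
    and avoid: "\<And>s. s \<in> M \<Longrightarrow> \<not> s \<le> p"
    and maximal: "\<And>x. p < x \<Longrightarrow> \<exists>s\<in>M. s \<le> x"
  shows "p \<in> Spec"
  unfolding Spec_def
proof (intro CollectI conjI allI impI)
  show "p < 1"
    using avoid[OF M(1)] quantale_le_one[of p] by (auto simp: less_le)
next
  fix a b assume ab: "a * b \<le> p"
  show "a \<le> p \<or> b \<le> p"
  proof (rule ccontr)
    assume "\<not> (a \<le> p \<or> b \<le> p)"
    then have "p < sup p a" "p < sup p b" by (auto simp: less_le_not_le)
    then obtain s t where "s \<in> M" "t \<in> M" "s \<le> sup p a" "t \<le> sup p b"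
      using maximal by blast
    moreover from this have "s * t \<le> p"
      using quantale_mult_mono[of s "sup p a" t "sup p b"] quantale_sup_mult_sup_le[of p a b] ab
      by (metis order_trans sup.absorb1)
    ultimately show False using M(2) avoid by blast
  qed
qed

text \<open>A compact \<open>s\<close> below the join of a nonempty chain is below a single member
  of it, so such joins still avoid \<open>M\<close> and Zorn's lemma applies.\<close>

lemma exists_maximal_avoiding:
  fixes a :: "'a::quantale"
  assumes compact: "M \<subseteq> compact_elements" and avoid: "\<And>s. s \<in> M \<Longrightarrow> \<not> s \<le> a"
  obtains p where "a \<le> p" "\<And>s. s \<in> M \<Longrightarrow> \<not> s \<le> p" "\<And>x. p < x \<Longrightarrow> \<exists>s\<in>M. s \<le> x"
proof -
  define A where "A = {x. a \<le> x \<and> (\<forall>s\<in>M. \<not> s \<le> x)}"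
  have "\<exists>p\<in>A. \<forall>x\<in>A. p \<le> x \<longrightarrow> x = p"
  proof (rule predicate_Zorn)
    show "partial_order_on A (relation_of (\<le>) A)"
      by (rule partial_order_on_relation_ofI) auto
    fix C assume C: "C \<in> Chains (relation_of (\<le>) A)"
    have chain: "x \<le> y \<or> y \<le> x" if "x \<in> C" "y \<in> C" for x y
      using C that by (auto simp: Chains_def relation_of_def)
    have CA: "C \<subseteq> A" using C by (auto simp: Chains_def relation_of_def)
    show "\<exists>u\<in>A. \<forall>x\<in>C. x \<le> u"
    proof (cases "C = {}")
      case True
      have "a \<in> A" using avoid by (auto simp: A_def)
      then show ?thesis using True by blast
    next
      case False
      then obtain x0 where x0: "x0 \<in> C" by auto
      then have "a \<le> Sup C" using CA by (auto simp: A_def intro: Sup_upper2)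
      moreover have "\<not> s \<le> Sup C" if "s \<in> M" for s
      proof
        assume "s \<le> Sup C"
        then obtain F where F: "finite F" "F \<subseteq> C" "s \<le> Sup F"
          using compact \<open>s \<in> M\<close> unfolding compact_elements_def by blast
        \<comment> \<open>Inserting \<open>x0\<close> handles an empty \<open>F\<close>, whose join
          \<open>bot\<close> need not belong to the chain.\<close>
        have "Sup (insert x0 F) \<in> insert x0 F"
          using F x0 chain by (intro Sup_finite_chain_mem) auto
        then have "Sup (insert x0 F) \<in> A" using F x0 CA by auto
        then show False
          using \<open>s \<in> M\<close> F by (auto simp: A_def intro: le_supI2)
      qed
      ultimately show ?thesis
        by (intro bexI[of _ "Sup C"]) (auto simp: A_def Sup_upper)
    qed
  qed
  then obtain p where p: "p \<in> A" "\<And>x. x \<in> A \<Longrightarrow> p \<le> x \<Longrightarrow> x = p" by blast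
  show ?thesis
  proof (rule that)
    show "a \<le> p" "\<And>s. s \<in> M \<Longrightarrow> \<not> s \<le> p" using p(1) by (auto simp: A_def)
    fix x assume "p < x"
    then have "x \<notin> A" using p(2)[of x] by (auto simp: less_le)
    moreover have "a \<le> x" using \<open>p < x\<close> p(1) by (auto simp: A_def)
    ultimately show "\<exists>s\<in>M. s \<le> x" by (auto simp: A_def)
  qed
qed

section \<open>Maximal elements, the map \<open>gamma\<close>, and comaximal compact
  elements\<close>

lemma MaxSpec_subset_Spec: "MaxSpec \<subseteq> (Spec :: 'a::quantale set)"
proof
  fix m :: 'a assume "m \<in> MaxSpec"
  \<comment> \<open>Being maximal below \<open>1\<close> is being maximal among the elements that
    avoid the multiplicative set \<open>{1}\<close>.\<close>
  then show "m \<in> Spec"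
    by (intro maximal_avoiding_in_Spec[of "{1}"])
      (auto simp: MaxSpec_def quantale_one_le_iff less_le)
qed

lemma MaxSpec_not_le:
  fixes m :: "'a::quantale"
  assumes "m \<in> MaxSpec" "\<not> x \<le> m"
  shows "sup x m = 1"
  using assms unfolding MaxSpec_def by (metis (mono_tags, lifting) mem_Collect_eq sup_ge1 sup_ge2)

lemma Spec_not_comaximal:
  fixes p :: "'a::quantale"
  assumes "p \<in> Spec" "sup a b = 1" "a \<le> p"
  shows "\<not> b \<le> p"
  using assms unfolding Spec_def by (metis (mono_tags, lifting) mem_Collect_eq le_sup_iff less_le_not_le)

lemma exists_MaxSpec_above:
  fixes a :: "'a::quantale"
  assumes "coherent_quantale TYPE('a)" "a \<noteq> 1"
  obtains m where "m \<in> MaxSpec" "a \<le> m"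
proof -
  have "{1} \<subseteq> (compact_elements :: 'a set)"
    using assms(1) by (simp add: coherent_quantale_def)
  moreover have "\<not> s \<le> a" if "s \<in> {1}" for s
    using that assms(2) by (auto simp: one_eq_top top_unique)
  ultimately obtain m where m: "a \<le> m" "\<And>s. s \<in> {1} \<Longrightarrow> \<not> s \<le> m" "\<And>x. m < x \<Longrightarrow> \<exists>s\<in>{1}. s \<le> x"
    using exists_maximal_avoiding[of "{1}" a] by metis
  then have "m \<in> MaxSpec"
    by (auto simp: MaxSpec_def one_eq_top top_unique less_le)
  with m(1) show ?thesis by (rule that[rotated])
qed

text \<open>Distinct maximal elements are comaximal. Normality then gives \<open>e\<close> and
  \<open>f\<close> with product \<open>bot\<close>, so \<open>p\<close> is above one of them; hence
  \<open>m\<close> is above \<open>e\<close> or \<open>n\<close> is above \<open>f\<close>, against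
  comaximality.\<close>

lemma MaxSpec_above_unique:
  fixes p :: "'a::quantale"
  assumes "normal_quantale TYPE('a)" and p: "p \<in> Spec"
    and m: "m \<in> MaxSpec" "p \<le> m" and n: "n \<in> MaxSpec" "p \<le> n"
  shows "m = n"
proof (rule ccontr)
  assume "m \<noteq> n"
  then have "\<not> m \<le> n" using m n by (auto simp: MaxSpec_def)
  with n have "sup m n = 1" by (intro MaxSpec_not_le)
  then obtain e f where ef: "sup m e = 1" "sup n f = 1" "e * f = bot"
    using assms(1) unfolding normal_quantale_def by blast
  from ef(3) p have "e \<le> p \<or> f \<le> p" by (auto simp: Spec_def)
  then have "e \<le> m \<or> f \<le> n" using m n by auto
  then show False
    using ef m n Spec_not_comaximal[of m m e] Spec_not_comaximal[of n n f] MaxSpec_subset_Spec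
    by auto
qed

lemma gamma_Spec:
  fixes p :: "'a::quantale"
  assumes "coherent_quantale TYPE('a)" "normal_quantale TYPE('a)" "p \<in> Spec"
  shows "gamma p \<in> MaxSpec" "p \<le> gamma p"
proof -
  have "p \<noteq> 1" using assms(3) by (auto simp: Spec_def)
  then obtain m where "m \<in> MaxSpec" "p \<le> m"
    using exists_MaxSpec_above assms(1) by blast
  then have "\<exists>!m. m \<in> MaxSpec \<and> p \<le> m"
    using MaxSpec_above_unique[OF assms(2,3)] by blast
  then have "gamma p \<in> MaxSpec \<and> p \<le> gamma p"
    unfolding gamma_def by (rule theI')
  then show "gamma p \<in> MaxSpec" "p \<le> gamma p" by auto
qed

lemma gamma_MaxSpec:
  fixes m :: "'a::quantale"
  assumes "coherent_quantale TYPE('a)" "normal_quantale TYPE('a)" "m \<in> MaxSpec"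
  shows "gamma m = m"
proof -
  have "m \<in> Spec" using assms(3) MaxSpec_subset_Spec by auto
  from gamma_Spec[OF assms(1,2) this] show ?thesis
    using assms(3) by (auto simp: MaxSpec_def)
qed

text \<open>Since \<open>b\<close> is a join of compact elements and \<open>1\<close> is compact,
  finitely many of them together with \<open>a\<close> already reach \<open>1\<close>.\<close>

lemma comaximal_compact:
  fixes a b :: "'a::quantale"
  assumes "coherent_quantale TYPE('a)" "sup a b = 1"
  obtains d where "d \<in> compact_elements" "d \<le> b" "sup a d = 1"
proof -
  obtain S where S: "S \<subseteq> compact_elements" "b = Sup S"
    using assms(1) unfolding coherent_quantale_def by blast
  have "1 \<le> Sup (insert a S)" using S assms(2) by simp
  moreover have "(1::'a) \<in> compact_elements"
    using assms(1) by (simp add: coherent_quantale_def)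
  ultimately obtain F where F: "finite F" "F \<subseteq> insert a S" "1 \<le> Sup F"
    unfolding compact_elements_def by blast
  have "Sup G \<in> compact_elements" if "finite G" "G \<subseteq> S" for G
    using that S(1) by (induction rule: finite_induct) (auto simp: bot_compact intro: sup_compact)
  then have "Sup (F - {a}) \<in> compact_elements" using F by blast
  moreover have "Sup (F - {a}) \<le> b" using F(2) S(2) by (auto intro: Sup_subset_mono)
  moreover have "Sup F \<le> sup a (Sup (F - {a}))"
    by (metis Sup_insert Sup_subset_mono insert_Diff_single subset_insertI)
  then have "sup a (Sup (F - {a})) = 1"
    using F(3) quantale_le_one by (metis order.trans order.antisym)
  ultimately show ?thesis by (rule that)
qed

section \<open>The flat topology and compactness of the spectrum\<close>

lemma openin_Spec_F_V: "c \<in> compact_elements \<Longrightarrow> openin Spec_F (V (c::'a::quantale))"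
  unfolding openin_Spec_F by (rule exI[of _ "{c}"]) auto

lemma topspace_Max_F: "topspace Max_F = (MaxSpec :: 'a::quantale set)"
  using MaxSpec_subset_Spec by (auto simp: Max_F_def topspace_Spec_F)

text \<open>The compact \<open>s\<close> whose \<open>V s\<close> is finitely covered form a
  multiplicative set \<open>M\<close>. If \<open>bot\<close> were not in \<open>M\<close>, some
  m-prime \<open>p\<close> would avoid \<open>M\<close>; but \<open>p\<close> lies in some
  \<open>V c\<close> inside a member of the cover, and such a \<open>c\<close> belongs to
  \<open>M\<close>.\<close>

lemma compact_space_Spec_F:
  assumes coh: "coherent_quantale TYPE('a::quantale)"
  shows "compact_space (Spec_F :: 'a topology)"
  unfolding compact_space_alt topspace_Spec_F
proof (intro allI impI)
  fix \<U> :: "'a set set"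
  assume "(\<forall>U\<in>\<U>. openin Spec_F U) \<and> Spec \<subseteq> \<Union> \<U>"
  then have opens: "\<And>U. U \<in> \<U> \<Longrightarrow> openin Spec_F U" and cover: "Spec \<subseteq> \<Union>\<U>" by auto
  define C where "C = {c \<in> compact_elements. \<exists>U\<in>\<U>. V c \<subseteq> U}"
  define M where "M = {s \<in> compact_elements.
    \<exists>F. finite F \<and> F \<subseteq> C \<and> (\<forall>p\<in>Spec. s \<le> p \<longrightarrow> (\<exists>c\<in>F. c \<le> p))}"
  have covered: "\<exists>c\<in>C. c \<le> p" if "p \<in> Spec" for p
  proof -
    from that cover obtain U where U: "U \<in> \<U>" "p \<in> U" by auto
    then obtain B where "B \<subseteq> compact_elements" "U = (\<Union>c\<in>B. V c)"
      using opens unfolding openin_Spec_F by meson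
    with U obtain c where "c \<in> compact_elements" "p \<in> V c" "V c \<subseteq> U" by blast
    with U(1) show ?thesis by (auto simp: C_def V_def)
  qed
  have "bot \<in> M"
  proof (rule ccontr)
    assume "bot \<notin> M"
    have "\<not> s \<le> bot" if "s \<in> M" for s
      using \<open>bot \<notin> M\<close> that by (auto simp: bot_unique)
    moreover have "M \<subseteq> compact_elements" by (auto simp: M_def)
    ultimately obtain p where p: "\<And>s. s \<in> M \<Longrightarrow> \<not> s \<le> p" "\<And>x. p < x \<Longrightarrow> \<exists>s\<in>M. s \<le> x"
      using exists_maximal_avoiding[of M bot] by metis
    have "p \<in> Spec"
    proof (rule maximal_avoiding_in_Spec[of M])
      \<comment> \<open>No m-prime element is above \<open>1\<close>, so the empty family covers
        \<open>V 1\<close>.\<close>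
      show "1 \<in> M"
        using coh unfolding M_def coherent_quantale_def
        by (auto simp: Spec_def less_le_not_le intro!: exI[of _ "{}"])
      fix s t assume "s \<in> M" "t \<in> M"
      then obtain F G where
        F: "s \<in> compact_elements" "finite F" "F \<subseteq> C" "\<forall>p\<in>Spec. s \<le> p \<longrightarrow> (\<exists>c\<in>F. c \<le> p)" and
        G: "t \<in> compact_elements" "finite G" "G \<subseteq> C" "\<forall>p\<in>Spec. t \<le> p \<longrightarrow> (\<exists>c\<in>G. c \<le> p)"
        unfolding M_def by blast
      have "\<exists>c\<in>F \<union> G. c \<le> q" if "q \<in> Spec" "s * t \<le> q" for q
      proof -
        from that have "s \<le> q \<or> t \<le> q" by (auto simp: Spec_def)
        with that(1) F(4) G(4) show ?thesis by blast
      qed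
      moreover have "s * t \<in> compact_elements"
        using coh F(1) G(1) by (auto simp: coherent_quantale_def)
      ultimately show "s * t \<in> M"
        unfolding M_def using F(2,3) G(2,3)
        by (intro CollectI conjI exI[of _ "F \<union> G"]) auto
    qed (use p in auto)
    then obtain c where "c \<in> C" "c \<le> p" using covered by blast
    moreover from this have "c \<in> M"
      unfolding M_def C_def by (auto intro!: exI[of _ "{c}"])
    ultimately show False using p(1) by blast
  qed
  \<comment> \<open>Every element is above \<open>bot\<close>, so a finite cover of
    \<open>V bot\<close> covers all of \<open>Spec\<close>.\<close>
  then obtain F where F: "finite F" "F \<subseteq> C" "\<forall>p\<in>Spec. \<exists>c\<in>F. c \<le> p"
    unfolding M_def by auto
  then have "\<forall>c\<in>F. \<exists>U\<in>\<U>. V c \<subseteq> U" by (auto simp: C_def)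
  then obtain g where g: "\<And>c. c \<in> F \<Longrightarrow> g c \<in> \<U> \<and> V c \<subseteq> g c" by metis
  show "\<exists>\<F>. finite \<F> \<and> \<F> \<subseteq> \<U> \<and> Spec \<subseteq> \<Union> \<F>"
  proof (intro exI conjI)
    show "finite (g ` F)" "g ` F \<subseteq> \<U>" using F g by auto
    show "Spec \<subseteq> \<Union> (g ` F)"
    proof
      fix p :: 'a assume "p \<in> Spec"
      then obtain c where "c \<in> F" "p \<in> V c" using F(3) by (auto simp: V_def)
      with g show "p \<in> \<Union> (g ` F)" by blast
    qed
  qed
qed

section \<open>Preimages of basic open sets when \<open>Max_F\<close> is compact\<close>

lemma compact_Max_F_complement:
  fixes c :: "'a::quantale"
  assumes coh: "coherent_quantale TYPE('a)" and comp: "compact_space (Max_F :: 'a topology)"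
    and c: "c \<in> compact_elements"
  obtains d where "sup c d = 1" "\<And>m. m \<in> MaxSpec \<Longrightarrow> c \<le> m \<or> d \<le> m"
proof -
  \<comment> \<open>The element \<open>c\<close> serves the maximal elements above it; any other
    maximal element is comaximal with \<open>c\<close>, hence above a compact \<open>d\<close>
    comaximal with \<open>c\<close>.\<close>
  define D where "D = insert c {d \<in> compact_elements. sup c d = 1}"
  have D: "D \<subseteq> compact_elements" using c by (auto simp: D_def)
  have "openin Max_F (MaxSpec \<inter> V d)" if "d \<in> D" for d
    unfolding Max_F_def using that D by (intro openin_subtopology_Int2 openin_Spec_F_V) auto
  then have opens: "\<forall>U\<in>(\<lambda>d. MaxSpec \<inter> V d) ` D. openin Max_F U" by blast
  have cover: "topspace Max_F \<subseteq> \<Union> ((\<lambda>d. MaxSpec \<inter> V d) ` D)"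
  proof
    fix m :: 'a assume "m \<in> topspace Max_F"
    then have m: "m \<in> MaxSpec" "m \<in> Spec"
      using MaxSpec_subset_Spec by (auto simp: topspace_Max_F)
    have "\<exists>d\<in>D. d \<le> m"
    proof (cases "c \<le> m")
      case False
      with m(1) have "sup c m = 1" by (intro MaxSpec_not_le)
      then obtain d where "d \<in> compact_elements" "d \<le> m" "sup c d = 1"
        using comaximal_compact coh by blast
      then show ?thesis by (auto simp: D_def)
    qed (auto simp: D_def)
    with m show "m \<in> \<Union> ((\<lambda>d. MaxSpec \<inter> V d) ` D)" by (auto simp: V_def)
  qed
  obtain \<F> where "finite \<F>" "\<F> \<subseteq> (\<lambda>d. MaxSpec \<inter> V d) ` D" "topspace Max_F \<subseteq> \<Union> \<F>"
    using comp opens cover unfolding compact_space_alt by meson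
  then obtain F where F: "finite F" "F \<subseteq> D" "MaxSpec \<subseteq> (\<Union>d\<in>F. MaxSpec \<inter> V d)"
    unfolding topspace_Max_F by (metis finite_subset_image)
  \<comment> \<open>\<open>c\<close> is removed before multiplying, as it is comaximal with itself
    only when it is \<open>1\<close>.\<close>
  have "\<And>x. x \<in> F - {c} \<Longrightarrow> sup c x = 1" using F(2) by (auto simp: D_def)
  then obtain d where d: "sup c d = 1" "\<forall>x\<in>F - {c}. d \<le> x"
    using comaximal_finite[of "F - {c}" c] F(1) by auto
  have "c \<le> m \<or> d \<le> m" if "m \<in> MaxSpec" for m
  proof -
    from that F(3) obtain x where "x \<in> F" "x \<le> m" by (auto simp: V_def)
    with d(2) show ?thesis by (cases "x = c") (auto intro: order_trans)
  qed
  with d(1) show ?thesis by (rule that)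
qed

text \<open>If \<open>c\<close> is below \<open>gamma p\<close>, then \<open>e\<close> is not below
  \<open>p\<close>, and \<open>e * f = bot\<close> forces \<open>f\<close> below \<open>p\<close>.
  Conversely, \<open>f\<close> below \<open>p\<close> keeps \<open>d\<close> from being below
  \<open>gamma p\<close>, which leaves \<open>c\<close>.\<close>

lemma gamma_vimage_V:
  fixes c :: "'a::quantale"
  assumes coh: "coherent_quantale TYPE('a)" and nor: "normal_quantale TYPE('a)"
    and comp: "compact_space (Max_F :: 'a topology)" and c: "c \<in> compact_elements"
  obtains f where "f \<in> compact_elements" "{p \<in> Spec. c \<le> gamma p} = V f"
proof -
  obtain d where d: "sup c d = 1" "\<And>m. m \<in> MaxSpec \<Longrightarrow> c \<le> m \<or> d \<le> m"
    using compact_Max_F_complement[OF coh comp c] by blast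
  obtain e f0 where ef0: "sup c e = 1" "sup d f0 = 1" "e * f0 = bot"
    using nor d(1) unfolding normal_quantale_def by blast
  \<comment> \<open>Shrinking \<open>f0\<close> to a compact \<open>f\<close> makes
    \<open>V f\<close> a basic open set and keeps the product with \<open>e\<close> at
    \<open>bot\<close>.\<close>
  obtain f where f: "f \<in> compact_elements" "f \<le> f0" "sup d f = 1"
    using comaximal_compact[OF coh ef0(2)] by blast
  have ef: "e * f = bot"
    using quantale_mult_mono[of e e f f0] f(2) ef0(3) by (simp add: bot_unique)
  have "c \<le> gamma p \<longleftrightarrow> f \<le> p" if p: "p \<in> Spec" for p
  proof -
    note g = gamma_Spec[OF coh nor p]
    have gS: "gamma p \<in> Spec" using g(1) MaxSpec_subset_Spec by auto
    show ?thesis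
    proof
      assume "c \<le> gamma p"
      then have "\<not> e \<le> p"
        using Spec_not_comaximal[OF gS ef0(1)] g(2) by (auto intro: order_trans)
      moreover have "e \<le> p \<or> f \<le> p" using p ef by (auto simp: Spec_def)
      ultimately show "f \<le> p" by blast
    next
      assume "f \<le> p"
      then have "f \<le> gamma p" using g(2) by (rule order_trans)
      then have "\<not> d \<le> gamma p" using Spec_not_comaximal[OF gS f(3)] by blast
      then show "c \<le> gamma p" using d(2) g(1) by blast
    qed
  qed
  then have "{p \<in> Spec. c \<le> gamma p} = V f" by (auto simp: V_def)
  with f(1) show ?thesis by (rule that)
qed

theorem theorem7p9:
  assumes "coherent_quantale TYPE('a::quantale)"
    and "normal_quantale TYPE('a)"
  shows "continuous_map (Spec_F :: 'a topology) Max_F gamma \<longleftrightarrow>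
         compact_space (Max_F :: 'a topology)"
proof
  assume "continuous_map (Spec_F :: 'a topology) Max_F gamma"
  then have "compactin Max_F (gamma ` (Spec :: 'a set))"
    using image_compactin compact_space_Spec_F[OF assms(1)]
    unfolding compact_space_def topspace_Spec_F by blast
  \<comment> \<open>\<open>gamma\<close> fixes every maximal element, so the compact image is all of
    \<open>MaxSpec\<close>.\<close>
  moreover have "gamma ` Spec = (MaxSpec :: 'a set)"
  proof
    show "gamma ` Spec \<subseteq> (MaxSpec :: 'a set)" using gamma_Spec(1)[OF assms] by blast
    show "(MaxSpec :: 'a set) \<subseteq> gamma ` Spec"
    proof
      fix m :: 'a assume "m \<in> MaxSpec"
      then show "m \<in> gamma ` Spec"
        using gamma_MaxSpec[OF assms] MaxSpec_subset_Spec by (intro image_eqI[of m gamma m]) auto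
    qed
  qed
  ultimately show "compact_space (Max_F :: 'a topology)"
    by (simp add: compact_space_def topspace_Max_F)
next
  assume comp: "compact_space (Max_F :: 'a topology)"
  \<comment> \<open>As \<open>Max_F\<close> is a subspace containing all values of
    \<open>gamma\<close> on \<open>Spec\<close>, continuity into \<open>Spec_F\<close>
    suffices.\<close>
  have "openin Spec_F {p \<in> topspace Spec_F. gamma p \<in> U}" if U: "openin Spec_F U" for U :: "'a set"
  proof -
    obtain C where C: "C \<subseteq> compact_elements" "U = (\<Union>c\<in>C. V c)"
      using U unfolding openin_Spec_F by blast
    have "{p \<in> topspace Spec_F. gamma p \<in> U} = (\<Union>c\<in>C. {p \<in> Spec. c \<le> gamma p})"
      unfolding C(2) topspace_Spec_F V_def
      using gamma_Spec(1)[OF assms] MaxSpec_subset_Spec by auto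
    moreover have "openin Spec_F {p \<in> Spec. c \<le> gamma p}" if "c \<in> C" for c
      using gamma_vimage_V[OF assms comp] that C(1) openin_Spec_F_V by (metis subsetD)
    ultimately show ?thesis by auto
  qed
  moreover have "gamma p \<in> MaxSpec" if "p \<in> Spec" for p :: 'a
    using gamma_Spec(1)[OF assms that] .
  ultimately have "continuous_map (Spec_F :: 'a topology) Spec_F gamma"
    using MaxSpec_subset_Spec by (auto simp: continuous_map_def topspace_Spec_F)
  then show "continuous_map (Spec_F :: 'a topology) Max_F gamma"
    unfolding Max_F_def continuous_map_in_subtopology
    using gamma_Spec(1)[OF assms] by (auto simp: topspace_Spec_F)
qed

end
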